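(* Let $1/\sqrt2<p\le1$, and in the $\mathrm{AOS}p$ model for online weighted matching with edge arrivals in general graphs let $H'\subseteq H$ be such that each $e\in H$ is drawn to $H'$ independently with probability $(1+\sqrt2)(1-p)/p$. Then the greedy-based edge-arrival algorithm with sample $E'=H'$ is $\left(\frac32-\sqrt2\right)$-competitive.
   Context: $\mathrm{AOS}p$ model (adversarial order with $p$-sampling) for matching with edge arrivals: (1) The adversary generates a finite graph $G=(V,E)$ with weights $w:E\to\mathbb{R}_{\ge0}$ (ties broken by a fixed consistent rule, so edge weights are totally ordered). (2) Each $e\in E$ is put in the history set $H$ independently with probability $p$; $p$ and the edges of $H$ with their weights are given to the online player upfront. The online set is $O=E\setminus H$. (3) The edges of $O$ arrive one by one in an adversarial order (which may depend on $H$); when an edge arrives its weight is revealed, and the player must immediately and irrevocably accept it (keeping accepted edges vertex-disjoint) or reject it. For $F\subseteq E$, $G[F]$ is the subgraph with edge set $F$. $\mathrm{OPT}$ is the (random) maximum weight of a matching in $G[O]$. An algorithm is $c$-competitive if $\mathrm{E}[\mathrm{ALG}]\ge c\cdot\mathrm{E}[\mathrm{OPT}]$ on every instance $(G,p)$, where $\mathrm{ALG}$ is the weight of its output matching and expectations are over $H$ and the algorithm's internal randomness (here, the choice of $H'$). $\mathrm{Greedy}(K)$: process the edges of $K$ in non-increasing order of weight, adding an edge to the matching iff neither endpoint is already covered. Greedy-based edge-arrival algorithm with sample $E'$: set $M=\emptyset$. When an edge $e=(u,v)\in O$ arrives, if $e\in\mathrm{Greedy}(G[E'\cup\{e\}])$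 and neither $u$ nor $v$ is matched in $M$, add $e$ to $M$. Output $M$. *)

theory Defs
  imports "HOL-Probability.Probability"
begin

type_synonym 'v edge = "'v set"

definition fin_graph :: "'v set \<Rightarrow> 'v edge set \<Rightarrow> bool" where
  "fin_graph V E \<longleftrightarrow> finite V \<and> (\<forall>e\<in>E. e \<subseteq> V \<and> card e = 2)"

definition matching :: "'v edge set \<Rightarrow> bool" where
  "matching M \<longleftrightarrow> pairwise disjnt M"

text \<open>The maximum weight of a matching in \<open>G[F]\<close>.\<close>

definition opt :: "('v edge \<Rightarrow> real) \<Rightarrow> 'v edge set \<Rightarrow> real" where
  "opt w F = Max (sum w ` {M. M \<subseteq> F \<and> matching M})"

definition uncovered :: "'v edge set \<Rightarrow> 'v edge \<Rightarrow> bool" where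
  "uncovered M e \<longleftrightarrow> e \<inter> \<Union>M = {}"

text \<open>
  The tie-breaking rule is a fixed enumeration \<open>ties\<close> of all edges. As \<^const>\<open>sort_key\<close> is stable,
  edges of equal weight are processed in the order in which \<open>ties\<close> lists them, so that every \<open>K\<close> is
  processed in one and the same total order on the edges. The result depends only on \<open>w\<close> and
  this order, both restricted to \<open>K\<close>.
\<close>

definition greedy :: "('v edge \<Rightarrow> real) \<Rightarrow> 'v edge list \<Rightarrow> 'v edge set \<Rightarrow> 'v edge set" where
  "greedy w ties K =
     foldl (\<lambda>M e. if uncovered M e then insert e M else M) {}
       (sort_key (\<lambda>e. - w e) (filter (\<lambda>e. e \<in> K) ties))"

definition greedy_edge_arrival ::
    "('v edge \<Rightarrow> real) \<Rightarrow> 'v edge list \<Rightarrow> 'v edge set \<Rightarrow> 'v edge list \<Rightarrow> 'v edge set" where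
  "greedy_edge_arrival w ties E' arrivals =
     foldl (\<lambda>M e. if e \<in> greedy w ties (insert e E') \<and> uncovered M e then insert e M else M) {}
       arrivals"

definition random_subset :: "real \<Rightarrow> 'a set \<Rightarrow> 'a set pmf" where
  "random_subset p A = map_pmf (\<lambda>f. {x \<in> A. f x}) (Pi_pmf A False (\<lambda>_. bernoulli_pmf p))"

text \<open>
  An algorithm maps weights, tie-breaking rule, history set and arrival sequence to the distribution
  of its output matching; the randomness is its internal one.
\<close>

type_synonym 'v algorithm =
  "('v edge \<Rightarrow> real) \<Rightarrow> 'v edge list \<Rightarrow> 'v edge set \<Rightarrow> 'v edge list \<Rightarrow> 'v edge set pmf"

text \<open>
  The greedy-based algorithm whose sample \<open>E'\<close> is drawn from the history set \<open>H\<close> according to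
  \<open>draw H\<close>, independently of the arrival order.
\<close>

definition greedy_based ::
    "('v edge set \<Rightarrow> 'v edge set pmf) \<Rightarrow> 'v algorithm" where
  "greedy_based draw w ties H arrivals =
     map_pmf (\<lambda>E'. greedy_edge_arrival w ties E' arrivals) (draw H)"

text \<open>
  Competitiveness in the AOS\<open>p\<close> model for a given sampling probability \<open>p\<close>. The adversary picks the
  graph, the weights and the tie-breaking rule, and for every history set \<open>H\<close> the order
  \<open>\<sigma> H\<close> in which the online edges \<open>E - H\<close> arrive; \<open>\<sigma>\<close> may thus depend on \<open>H\<close>, but not on the
  internal randomness of the algorithm.
\<close>

definition competitive :: "real \<Rightarrow> real \<Rightarrow> 'v algorithm \<Rightarrow> bool" where
  "competitive p c alg \<longleftrightarrow>
     (\<forall>V E w ties \<sigma>.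
        fin_graph V E \<longrightarrow> (\<forall>e\<in>E. 0 \<le> w e) \<longrightarrow> ties \<in> permutations_of_set E \<longrightarrow>
        (\<forall>H\<subseteq>E. \<sigma> H \<in> permutations_of_set (E - H)) \<longrightarrow>
        measure_pmf.expectation
            (bind_pmf (random_subset p E) (\<lambda>H. alg w ties H (\<sigma> H))) (\<lambda>M. sum w M)
          \<ge> c * measure_pmf.expectation (random_subset p E) (\<lambda>H. opt w (E - H)))"

end

theory Submission
  imports Defs
begin

text \<open>
  Let \<open>K\<close> be the sample and \<open>A\<close> the set of online edges \<open>e\<close> that are in the greedy matching of
  \<open>K \<union> {e}\<close>. Every edge is in \<open>K\<close> exactly \<open>l = 1 + sqrt 2\<close> times as often as it is online, so
  resampling one edge shows that the expected weight of \<open>A\<close> is \<open>1 / l\<close> times that of the greedy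
  matching of \<open>K\<close>, which is at least half of the optimum on \<open>K\<close>; the latter dominates the optimum on
  the online edges, since \<open>K\<close> is the larger random set.
  The algorithm outputs a maximal matching in \<open>A\<close>, and whatever the arrival order, it loses at most
  the weight of the edges of \<open>A\<close>, counted once for each endpoint at which they are not the last edge
  of \<open>A\<close>. Resampling the first later edge of \<open>A\<close> at that endpoint shows that this happens with
  conditional probability at most \<open>1 / (1 + l)\<close>. Altogether the ratio is
  \<open>(1 - 2 / (1 + l)) / (2 * l)\<close>, and the choice of \<open>l\<close> maximizes it.
\<close>

section \<open>First-fit matchings\<close>

text \<open>Greedy and the online algorithm both scan a list and accept each edge that passes a test
  and still fits. They differ only in list and test, so their common properties are proved
  once.\<close>

definition first_fit :: "('v edge \<Rightarrow> bool) \<Rightarrow> 'v edge list \<Rightarrow> 'v edge set" where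
  "first_fit P xs = foldl (\<lambda>M e. if P e \<and> uncovered M e then insert e M else M) {} xs"

lemma first_fit_Nil [simp]: "first_fit P [] = {}"
  by (simp add: first_fit_def)

lemma first_fit_snoc:
  "first_fit P (xs @ [x]) =
     (if P x \<and> uncovered (first_fit P xs) x then insert x (first_fit P xs) else first_fit P xs)"
  by (simp add: first_fit_def)

lemma first_fit_subset: "first_fit P xs \<subseteq> {e \<in> set xs. P e}"
  by (induction xs rule: rev_induct) (auto simp: first_fit_snoc)

lemma matching_first_fit: "matching (first_fit P xs)"
  by (induction xs rule: rev_induct)
    (auto simp: first_fit_snoc matching_def pairwise_insert uncovered_def disjnt_def)

text \<open>An edge that passes the test is rejected only if it meets an edge accepted earlier, and
  accepted edges are never removed. So the result is maximal among the edges passing the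
  test.\<close>

lemma first_fit_blocked:
  assumes "e \<in> set xs" "P e" "e \<notin> first_fit P xs"
  shows "\<exists>f\<in>first_fit P xs. e \<inter> f \<noteq> {}"
  using assms
  by (induction xs rule: rev_induct) (auto simp: first_fit_snoc uncovered_def split: if_splits)

text \<open>In a list of strictly increasing rank, the edges accepted before \<open>e\<close> is
  scanned are exactly the accepted edges of smaller rank. Membership thus needs no intermediate
  state of the scan.\<close>

lemma mem_first_fit_iff:
  fixes r :: "'v edge \<Rightarrow> nat"
  assumes "sorted_wrt (\<lambda>a b. r a < r b) xs"
  shows "e \<in> first_fit P xs \<longleftrightarrow>
           e \<in> set xs \<and> P e \<and> (\<forall>f\<in>first_fit P xs. r f < r e \<longrightarrow> e \<inter> f = {})"
  using assms
proof (induction xs arbitrary: e rule: rev_induct)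
  case Nil
  then show ?case by simp
next
  case (snoc x xs)
  have sorted: "sorted_wrt (\<lambda>a b. r a < r b) xs" and last: "\<And>y. y \<in> set xs \<Longrightarrow> r y < r x"
    using snoc.prems by (auto simp: sorted_wrt_append)
  have sub: "first_fit P xs \<subseteq> set xs"
    using first_fit_subset[of P xs] by auto
  show ?case
  proof (cases "e = x")
    case True
    have "x \<notin> first_fit P xs"
      using sub last by blast
    then show ?thesis
      using True sub last by (auto simp: first_fit_snoc uncovered_def)
  next
    case False
    show ?thesis
    proof (cases "e \<in> set xs")
      case True
      then show ?thesis
        using False snoc.IH[OF sorted, of e] last[OF True] by (auto simp: first_fit_snoc)
    next
      case False
      then show ?thesis
        using \<open>e \<noteq> x\<close> sub by (auto simp: first_fit_snoc)
    qed
  qed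
qed

lemma foldl_filter_eq:
  "foldl (\<lambda>M e. if Q M e then f e M else M) M (filter P xs) =
     foldl (\<lambda>M e. if P e \<and> Q M e then f e M else M) M xs"
  by (induction xs arbitrary: M) auto

text \<open>Stable sorting commutes with filtering, so \<open>K\<close> moves into the test and the
  scanned list is the same for all \<open>K\<close>. One rank function then serves every
  sample.\<close>

lemma greedy_eq_first_fit:
  "greedy w ties K = first_fit (\<lambda>e. e \<in> K) (sort_key (\<lambda>e. - w e) ties)"
  unfolding greedy_def first_fit_def filter_sort[symmetric] by (rule foldl_filter_eq)

lemma greedy_edge_arrival_eq_first_fit:
  "greedy_edge_arrival w ties K xs = first_fit (\<lambda>e. e \<in> greedy w ties (insert e K)) xs"
  unfolding greedy_edge_arrival_def first_fit_def ..

lemma obtain_rank: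
  assumes "distinct xs"
  obtains r :: "'a \<Rightarrow> nat" where "sorted_wrt (\<lambda>a b. r a < r b) xs"
proof
  have "inj_on ((!) xs) {..<length xs}"
    using assms by (auto simp: inj_on_def nth_eq_iff_index_eq)
  then show "sorted_wrt (\<lambda>a b. the_inv_into {..<length xs} ((!) xs) a
                < the_inv_into {..<length xs} ((!) xs) b) xs"
    by (auto simp: sorted_wrt_iff_nth_less the_inv_into_f_f)
qed

section \<open>Random subsets\<close>

lemma set_random_subset:
  "set_pmf (random_subset p A) \<subseteq> Pow A"
  by (auto simp: random_subset_def)

lemma pmf_random_subset:
  assumes "finite A" "X \<subseteq> A" "0 \<le> p" "p \<le> 1"
  shows "pmf (random_subset p A) X = p ^ card X * (1 - p) ^ card (A - X)"
proof -
  let ?P = "Pi_pmf A False (\<lambda>_. bernoulli_pmf p)"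
  \<comment> \<open>Functions in the support take the default value \<open>False\<close> outside
    \<open>A\<close>, so \<open>X\<close> determines such a function everywhere.\<close>
  have eq: "{x \<in> A. f x} = X \<longleftrightarrow> f = (\<lambda>x. x \<in> X)" if "f \<in> set_pmf ?P" for f
    using that \<open>X \<subseteq> A\<close> set_Pi_pmf_subset[OF \<open>finite A\<close>, of False "\<lambda>_. bernoulli_pmf p"]
    by (auto simp: fun_eq_iff)
  have "pmf (random_subset p A) X = measure_pmf.prob ?P ((\<lambda>f. {x \<in> A. f x}) -` {X})"
    by (simp add: random_subset_def pmf_map)
  also have "\<dots> = measure_pmf.prob ?P {\<lambda>x. x \<in> X}"
    by (rule measure_prob_cong_0) (use eq in \<open>auto simp: set_pmf_iff\<close>)
  also have "\<dots> = (\<Prod>x\<in>A. pmf (bernoulli_pmf p) (x \<in> X))"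
    using assms by (subst measure_pmf_single, subst pmf_Pi) auto
  also have "\<dots> = (\<Prod>x\<in>X \<union> (A - X). pmf (bernoulli_pmf p) (x \<in> X))"
    using \<open>X \<subseteq> A\<close> by (simp add: Un_absorb1)
  also have "\<dots> = p ^ card X * (1 - p) ^ card (A - X)"
    using assms by (subst prod.union_disjoint) (auto intro: finite_subset)
  finally show ?thesis .
qed

text \<open>Tossing a \<open>q\<close>-coin after a successful \<open>p\<close>-coin amounts to one
  coin of bias \<open>p * q\<close>, independently for each element.\<close>

lemma random_subset_random_subset:
  assumes "finite A" "0 \<le> p" "p \<le> 1" "0 \<le> q" "q \<le> 1"
  shows "bind_pmf (random_subset p A) (random_subset q) = random_subset (p * q) A"
proof -
  have pq: "0 \<le> p * q" "p * q \<le> 1"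
    using assms by (auto intro: mult_le_one)
  have bern: "bernoulli_pmf (p * q) =
      bind_pmf (bernoulli_pmf p) (\<lambda>b. if b then bernoulli_pmf q else return_pmf False)"
  proof (rule pmf_eqI)
    fix b
    show "pmf (bernoulli_pmf (p * q)) b =
        pmf (bind_pmf (bernoulli_pmf p)
          (\<lambda>b. if b then bernoulli_pmf q else return_pmf False)) b"
      using assms pq by (cases b) (simp_all add: pmf_bind algebra_simps)
  qed
  have "random_subset (p * q) A = bind_pmf (Pi_pmf A False (\<lambda>_. bernoulli_pmf p))
      (\<lambda>f. map_pmf (\<lambda>g. {x \<in> A. g x}) (Pi_pmf {x \<in> A. f x} False (\<lambda>_. bernoulli_pmf q)))"
    unfolding random_subset_def bern
    by (subst Pi_pmf_bind[OF \<open>finite A\<close>, where d' = False])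
      (simp add: map_bind_pmf Pi_pmf_if_set[OF \<open>finite A\<close>])
  also have "\<dots> = bind_pmf (Pi_pmf A False (\<lambda>_. bernoulli_pmf p))
      (\<lambda>f. random_subset q {x \<in> A. f x})"
    unfolding random_subset_def
  proof (intro bind_pmf_cong map_pmf_cong refl)
    fix f g
    assume "g \<in> set_pmf (Pi_pmf {x \<in> A. f x} False (\<lambda>_. bernoulli_pmf q))"
    then show "{x \<in> A. g x} = {x \<in> {x \<in> A. f x}. g x}"
      using set_Pi_pmf_subset[of "{x \<in> A. f x}" False "\<lambda>_. bernoulli_pmf q"] \<open>finite A\<close>
      by auto
  qed
  also have "\<dots> = bind_pmf (random_subset p A) (random_subset q)"
    unfolding random_subset_def[of p A] by (simp add: bind_map_pmf)
  finally show ?thesis ..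
qed

lemma random_subset_compl:
  assumes "finite A" "0 \<le> p" "p \<le> 1"
  shows "map_pmf (\<lambda>X. A - X) (random_subset p A) = random_subset (1 - p) A"
proof (rule pmf_eqI)
  fix X
  show "pmf (map_pmf (\<lambda>X. A - X) (random_subset p A)) X = pmf (random_subset (1 - p) A) X"
  proof (cases "X \<subseteq> A")
    case True
    have "pmf (map_pmf (\<lambda>X. A - X) (random_subset p A)) X =
        measure_pmf.prob (random_subset p A) {A - X}"
      unfolding pmf_map
      by (rule measure_prob_cong_0)
        (use True set_random_subset[of p A] in \<open>auto simp: set_pmf_iff\<close>)
    also have "\<dots> = pmf (random_subset p A) (A - X)"
      by (rule measure_pmf_single)
    finally show ?thesis
      using assms True by (simp add: pmf_random_subset double_diff mult.commute)
  next
    case False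
    then have "X \<notin> set_pmf (map_pmf (\<lambda>X. A - X) (random_subset p A))"
      "X \<notin> set_pmf (random_subset (1 - p) A)"
      using set_random_subset[of "1 - p" A] by auto
    then show ?thesis
      by (simp only: set_pmf_iff) simp
  qed
qed


section \<open>Greedy matchings in a ranked graph\<close>

locale ranked_graph =
  fixes E :: "'v edge set" and w :: "'v edge \<Rightarrow> real" and ties :: "'v edge list"
    and r :: "'v edge \<Rightarrow> nat"
  assumes finite_E: "finite E"
    and card_edge: "e \<in> E \<Longrightarrow> card e = 2"
    and weight_nonneg: "e \<in> E \<Longrightarrow> 0 \<le> w e"
    and ties: "ties \<in> permutations_of_set E"
    and rank: "sorted_wrt (\<lambda>a b. r a < r b) (sort_key (\<lambda>e. - w e) ties)"
begin

text \<open>\<open>e\<close> need not lie in \<open>K\<close>: for an edge \<open>e\<close> of the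
  graph this says that greedy would accept \<open>e\<close> if \<open>e\<close> were added to
  \<open>K\<close>.\<close>

definition cand :: "'v edge set \<Rightarrow> 'v edge \<Rightarrow> bool" where
  "cand K e \<longleftrightarrow> (\<forall>f\<in>greedy w ties K. r f < r e \<longrightarrow> e \<inter> f = {})"

abbreviation gr :: "'v edge set \<Rightarrow> 'v edge set" where
  "gr \<equiv> greedy w ties"

lemma set_sorted: "set (sort_key (\<lambda>e. - w e) ties) = E"
  using ties by (simp add: permutations_of_set_def)

lemma finite_edge: "e \<in> E \<Longrightarrow> finite e"
  using card_edge by (metis card.infinite zero_neq_numeral)

lemma edge_nonempty: "e \<in> E \<Longrightarrow> e \<noteq> {}"
  using card_edge by force

lemma mem_gr_iff: "e \<in> gr K \<longleftrightarrow> e \<in> E \<and> e \<in> K \<and> cand K e"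
  unfolding cand_def unfolding greedy_eq_first_fit set_sorted[symmetric]
  by (rule mem_first_fit_iff[OF rank])

lemma gr_subset: "gr K \<subseteq> K" "gr K \<subseteq> E"
  using mem_gr_iff by auto

lemma rank_weight:
  assumes "e \<in> E" "f \<in> E"
  shows "r e < r f \<Longrightarrow> w f \<le> w e" "r e = r f \<Longrightarrow> e = f"
proof -
  let ?xs = "sort_key (\<lambda>e. - w e) ties"
  obtain i j where ij: "i < length ?xs" "j < length ?xs" "?xs ! i = e" "?xs ! j = f"
    using assms set_sorted by (metis in_set_conv_nth)
  have mono: "r (?xs ! a) < r (?xs ! b)" if "a < b" "b < length ?xs" for a b
    using rank that by (auto simp: sorted_wrt_iff_nth_less)
  have "sorted (map (\<lambda>e. - w e) ?xs)"
    by simp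
  then have weight: "w (?xs ! b) \<le> w (?xs ! a)" if "a < b" "b < length ?xs" for a b
    using that sorted_nth_mono[of "map (\<lambda>e. - w e) ?xs" a b] by simp
  show "w f \<le> w e" if "r e < r f"
    using mono[of j i] weight[of i j] ij that by (cases i j rule: linorder_cases) auto
  show "e = f" if "r e = r f"
    using mono[of j i] mono[of i j] ij that by (cases i j rule: linorder_cases) auto
qed

text \<open>By induction on the rank, the decisions of greedy before \<open>e\<close> depend only on
  the part of \<open>K\<close> ranked before \<open>e\<close>. This locality is what makes
  resampling an edge harmless for all edges up to it.\<close>

lemma cand_cong:
  assumes "\<And>f. f \<in> E \<Longrightarrow> r f < r e \<Longrightarrow> f \<in> K \<longleftrightarrow> f \<in> K'"
  shows "cand K e \<longleftrightarrow> cand K' e"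
  using assms
proof (induction "r e" arbitrary: e rule: less_induct)
  case less
  have "f \<in> gr K \<longleftrightarrow> f \<in> gr K'" if "r f < r e" for f
    unfolding mem_gr_iff using less.hyps[OF that] less.prems that by auto
  then show ?case
    unfolding cand_def by auto
qed

lemma cand_insert_later:
  assumes "e \<in> E" "r e \<le> r f"
  shows "cand (insert f K) e \<longleftrightarrow> cand K e"
  by (rule cand_cong) (use assms in auto)

lemma mem_gr_insert_iff: "e \<in> E \<Longrightarrow> e \<in> gr (insert e K) \<longleftrightarrow> cand K e"
  by (simp add: mem_gr_iff cand_insert_later)

section \<open>Greedy against the optimum, and the weight of maximal matchings\<close>

text \<open>Charging: each edge \<open>e\<close> of \<open>M\<close> is charged to a greedy edge
  \<open>b e\<close> at least as heavy, at a common vertex \<open>v e\<close>. A greedy edge has two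
  endpoints and is charged at most once at each.\<close>

lemma matching_le_two_gr:
  assumes "M \<subseteq> K" "K \<subseteq> E" "matching M"
  shows "sum w M \<le> 2 * sum w (gr K)"
proof -
  have fin: "finite M" "finite (gr K)"
    using assms gr_subset(2) finite_E by (meson finite_subset subset_trans)+
  have "\<exists>f v. f \<in> gr K \<and> v \<in> e \<and> v \<in> f \<and> w e \<le> w f" if e: "e \<in> M" for e
  proof (cases "e \<in> gr K")
    case True
    then show ?thesis
      using edge_nonempty assms e by blast
  next
    case False
    then obtain f where f: "f \<in> gr K" "r f < r e" "e \<inter> f \<noteq> {}"
      using e assms unfolding mem_gr_iff[of e] cand_def by blast
    then show ?thesis
      using rank_weight(1)[of f e] e assms gr_subset(2) by blast
  qed
  then obtain b v where bv: "\<And>e. e \<in> M \<Longrightarrow> b e \<in> gr K \<and> v e \<in> e \<and> v e \<in> b e \<and> w e \<le> w (b e)"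
    by metis
  \<comment> \<open>Two edges of \<open>M\<close> with the same charge would share a vertex.\<close>
  have inj: "inj_on (\<lambda>e. (b e, v e)) M"
    using bv assms(3) unfolding inj_on_def matching_def pairwise_def disjnt_def by (metis disjoint_iff prod.inject)
  have "sum w M \<le> (\<Sum>e\<in>M. w (fst (b e, v e)))"
    using bv by (auto intro: sum_mono)
  also have "\<dots> = (\<Sum>x\<in>(\<lambda>e. (b e, v e)) ` M. w (fst x))"
    by (subst sum.reindex[OF inj]) (simp add: o_def)
  also have "\<dots> \<le> (\<Sum>x\<in>Sigma (gr K) (\<lambda>f. f). w (fst x))"
    using fin bv gr_subset(2) finite_edge weight_nonneg
    by (intro sum_mono2 finite_SigmaI) (auto dest!: subsetD[OF gr_subset(2)])
  also have "\<dots> = (\<Sum>f\<in>gr K. \<Sum>_\<in>f. w f)"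
    using fin gr_subset(2) finite_edge by (subst sum.Sigma) (auto simp: case_prod_unfold)
  also have "\<dots> = (\<Sum>f\<in>gr K. 2 * w f)"
    using gr_subset(2) card_edge by (intro sum.cong) auto
  finally show ?thesis
    by (simp add: sum_distrib_left)
qed

lemma opt_le_two_gr:
  assumes "K \<subseteq> E"
  shows "opt w K \<le> 2 * sum w (gr K)"
proof -
  have "finite {M. M \<subseteq> K \<and> matching M}"
    using finite_subset[OF assms finite_E] by simp
  moreover have "{} \<in> {M. M \<subseteq> K \<and> matching M}"
    by (simp add: matching_def)
  ultimately show ?thesis
    unfolding opt_def by (intro Max.boundedI) (auto intro: matching_le_two_gr[OF _ assms])
qed

lemma opt_mono:
  assumes "F \<subseteq> G" "G \<subseteq> E"
  shows "opt w F \<le> opt w G"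
proof -
  have "finite G"
    using assms(2) finite_E by (rule finite_subset)
  moreover have "{} \<in> {M. M \<subseteq> F \<and> matching M}"
    by (simp add: matching_def)
  ultimately show ?thesis
    unfolding opt_def using assms(1) by (intro Max_mono image_mono) auto
qed

text \<open>
  At a vertex \<open>u\<close> covered by \<open>M\<close>, all edges of \<open>A\<close> but the one in \<open>M\<close> may be lost; their weight is
  at most that of all edges of \<open>A\<close> at \<open>u\<close> but the lightest. Vertices that \<open>M\<close> leaves uncovered lose
  nothing, because every lost edge has an endpoint covered by \<open>M\<close>.
\<close>

lemma maximal_matching_weight:
  assumes "A \<subseteq> E" "M \<subseteq> A" "matching M"
    and maximal: "\<And>e. e \<in> A \<Longrightarrow> e \<notin> M \<Longrightarrow> \<exists>f\<in>M. e \<inter> f \<noteq> {}"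
  shows "sum w A - sum w M \<le> (\<Sum>e\<in>A. \<Sum>u\<in>e. if \<exists>f\<in>A. u \<in> f \<and> r e < r f then w e else 0)"
proof -
  have fin: "finite A" "finite M"
    using assms finite_E by (meson finite_subset subset_trans)+
  define C where "C = \<Union>M"
  define N where "N = (\<lambda>u. {e \<in> A. u \<in> e})"
  define L where "L = (\<lambda>u. {e \<in> N u. \<exists>f\<in>N u. r e < r f})"
  have fin_C: "finite C" "finite (\<Union>A)"
    unfolding C_def using fin assms finite_edge by (auto intro!: finite_Union)
  have fin_N: "finite (N u)" for u
    unfolding N_def using fin by simp
  have nonneg: "0 \<le> w e" if "e \<in> A" for e
    using that assms weight_nonneg by blast
  have vertex: "sum w (N u - M) \<le> sum w (L u)" if u: "u \<in> C" for u
  proof -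
    obtain g where g: "g \<in> M" "u \<in> g"
      using u unfolding C_def by blast
    then have gN: "g \<in> N u"
      using assms unfolding N_def by blast
    obtain l where l: "l \<in> N u" "\<And>e. e \<in> N u \<Longrightarrow> r e \<le> r l"
      using obtains_MAX[OF fin_N, of u r] gN fin_N Max_ge[of "r ` N u"]
      by (metis empty_iff finite_imageI imageI)
    have L_eq: "L u = N u - {l}"
    proof -
      have "e = l" if "e \<in> N u" "\<not> r e < r l" for e
        using rank_weight(2)[of e l] l that assms(1) by (force simp: N_def)
      then show ?thesis
        using l unfolding L_def by (auto simp: not_less[symmetric])
    qed
    \<comment> \<open>\<open>l\<close> is the last edge of \<open>A\<close> at \<open>u\<close>,
      hence a lightest one, so removing it leaves at least as much weight as removing the matched
      edge \<open>g\<close>.\<close>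
    have "w l \<le> w g"
    proof (cases "r g < r l")
      case True
      then show ?thesis
        using rank_weight(1)[of g l] gN l assms(1) by (auto simp: N_def)
    next
      case False
      then show ?thesis
        using rank_weight(2)[of g l] gN l(1) l(2)[OF gN] assms(1) by (auto simp: N_def)
    qed
    have "sum w (N u - M) \<le> sum w (N u - {g})"
      using g fin_N nonneg by (intro sum_mono2) (auto simp: N_def)
    also have "\<dots> = sum w (N u) - w g"
      using gN fin_N by (simp add: sum_diff1)
    also have "\<dots> \<le> sum w (N u) - w l"
      using \<open>w l \<le> w g\<close> by simp
    also have "\<dots> = sum w (L u)"
      using l(1) fin_N by (simp add: L_eq sum_diff1)
    finally show ?thesis .
  qed
  have "sum w A - sum w M = sum w (A - M)"
    using fin assms by (simp add: sum_diff)
  \<comment> \<open>By maximality each lost edge has an endpoint in \<open>C\<close>, so it is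
    counted at least once.\<close>
  also have "\<dots> \<le> (\<Sum>e\<in>A - M. \<Sum>u\<in>{u. u \<in> C \<and> u \<in> e}. w e)"
  proof (rule sum_mono)
    fix e assume e: "e \<in> A - M"
    then obtain u where u: "u \<in> {u. u \<in> C \<and> u \<in> e}"
      using maximal unfolding C_def by blast
    then show "w e \<le> (\<Sum>u\<in>{u. u \<in> C \<and> u \<in> e}. w e)"
      using member_le_sum[OF u, of "\<lambda>_. w e"] nonneg e fin_C by simp
  qed
  also have "\<dots> = (\<Sum>u\<in>C. \<Sum>e\<in>{e. e \<in> A - M \<and> u \<in> e}. w e)"
    using fin fin_C by (intro sum.swap_restrict) auto
  also have "\<dots> = (\<Sum>u\<in>C. sum w (N u - M))"
    by (intro sum.cong) (auto simp: N_def)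
  also have "\<dots> \<le> (\<Sum>u\<in>C. sum w (L u))"
    by (rule sum_mono) (rule vertex)
  also have "\<dots> \<le> (\<Sum>u\<in>\<Union>A. sum w (L u))"
    using fin_C nonneg assms(2) unfolding C_def
    by (intro sum_mono2) (auto intro!: sum_nonneg simp: L_def N_def)
  also have "\<dots> = (\<Sum>u\<in>\<Union>A. \<Sum>e\<in>{e. e \<in> A \<and> u \<in> e}. if \<exists>f\<in>A. u \<in> f \<and> r e < r f then w e else 0)"
  proof (rule sum.cong)
    fix u
    have "L u = {e \<in> N u. \<exists>f\<in>A. u \<in> f \<and> r e < r f}"
      by (auto simp: L_def N_def)
    then show "sum w (L u) =
        (\<Sum>e\<in>{e. e \<in> A \<and> u \<in> e}. if \<exists>f\<in>A. u \<in> f \<and> r e < r f then w e else 0)"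
      using sum.inter_filter[OF fin_N[of u], of w "\<lambda>e. \<exists>f\<in>A. u \<in> f \<and> r e < r f"]
      by (simp only: N_def)
  qed simp
  also have "\<dots> = (\<Sum>e\<in>A. \<Sum>u\<in>{u. u \<in> \<Union>A \<and> u \<in> e}. if \<exists>f\<in>A. u \<in> f \<and> r e < r f then w e else 0)"
    by (rule sum.swap_restrict[OF fin_C(2) fin(1)])
  also have "\<dots> = (\<Sum>e\<in>A. \<Sum>u\<in>e. if \<exists>f\<in>A. u \<in> f \<and> r e < r f then w e else 0)"
    by (intro sum.cong refl) auto
  finally show ?thesis .
qed

end


section \<open>Sampling\<close>

text \<open>
  An edge is in the sample \<open>K\<close> with probability \<open>p * q\<close>, online with probability \<open>1 - p\<close>, and neither
  otherwise; \<open>l\<close> is the ratio of the first two.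
\<close>

locale sampled_graph = ranked_graph +
  fixes p q l :: real
  assumes p: "0 \<le> p" "p \<le> 1" and q: "0 \<le> q" "q \<le> 1"
    and l: "1 \<le> l" and pq: "p * q = l * (1 - p)"
begin

text \<open>This pair carries all the randomness: the arrival order is a function of
  \<open>H\<close>.\<close>

definition joint :: "('a set set \<times> 'a set set) pmf" where
  "joint = bind_pmf (random_subset p E) (\<lambda>H. map_pmf (Pair H) (random_subset q H))"

abbreviation pr :: "('a set set \<Rightarrow> 'a set set \<Rightarrow> bool) \<Rightarrow> real" where
  "pr D \<equiv> measure_pmf.prob joint {(H, K). D H K}"

lemma set_joint: "set_pmf joint \<subseteq> Sigma (Pow E) Pow"
  unfolding joint_def using set_random_subset by fastforce

lemma finite_subset_pairs: "finite (Sigma (Pow E) Pow)"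
  by (rule finite_SigmaI) (use finite_E in \<open>auto dest: finite_subset\<close>)

lemma integrable_joint [simp]: "integrable (measure_pmf joint) (g :: _ \<Rightarrow> real)"
  by (rule integrable_measure_pmf_finite) (rule finite_subset[OF set_joint finite_subset_pairs])

lemma pmf_joint:
  assumes "H \<subseteq> E" "K \<subseteq> H"
  shows "pmf joint (H, K) =
    p ^ card H * (1 - p) ^ card (E - H) * (q ^ card K * (1 - q) ^ card (H - K))"
proof -
  have "pmf (map_pmf (Pair X) (random_subset q X)) (H, K) =
      indicat_real {H} X * pmf (random_subset q H) K" for X
  proof (cases "X = H")
    case True
    then show ?thesis
      using pmf_map_inj'[of "Pair H"] by (simp add: inj_def)
  next
    case False
    then show ?thesis
      by (auto simp: pmf_eq_0_set_pmf)
  qed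
  then have "pmf joint (H, K) = pmf (random_subset p E) H * pmf (random_subset q H) K"
    by (simp add: joint_def pmf_bind measure_pmf_single)
  then show ?thesis
    using assms p q finite_E finite_subset[OF assms(1)] by (simp add: pmf_random_subset)
qed

lemma pr_eq_sum:
  "pr D = (\<Sum>x\<in>{(H, K). H \<subseteq> E \<and> K \<subseteq> H \<and> D H K}. pmf joint x)"
proof -
  have "pr D = measure_pmf.prob joint {(H, K). H \<subseteq> E \<and> K \<subseteq> H \<and> D H K}"
    by (rule measure_prob_cong_0) (use set_joint in \<open>auto simp: set_pmf_iff\<close>)
  also have "\<dots> = (\<Sum>x\<in>{(H, K). H \<subseteq> E \<and> K \<subseteq> H \<and> D H K}. pmf joint x)"
    by (rule measure_measure_pmf_finite) (rule finite_subset[OF _ finite_subset_pairs], auto)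
  finally show ?thesis .
qed

lemma joint_mono:
  fixes g h :: "'a set set \<Rightarrow> 'a set set \<Rightarrow> real"
  assumes "\<And>H K. H \<subseteq> E \<Longrightarrow> K \<subseteq> H \<Longrightarrow> g H K \<le> h H K"
  shows "measure_pmf.expectation joint (\<lambda>(H, K). g H K) \<le>
         measure_pmf.expectation joint (\<lambda>(H, K). h H K)"
  by (rule integral_mono_AE) (use assms set_joint in \<open>auto simp: AE_measure_pmf_iff\<close>)

lemma pr_eq_expectation:
  "pr D = measure_pmf.expectation joint (\<lambda>(H, K). of_bool (D H K))"
proof -
  have "(\<lambda>(H, K). of_bool (D H K)) = indicat_real {(H, K). D H K}"
    by (auto simp: fun_eq_iff indicator_def)
  then show ?thesis
    by simp
qed

lemma sum_pr_eq_expectation: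
  "(\<Sum>f\<in>F. pr (D f)) = measure_pmf.expectation joint (\<lambda>(H, K). \<Sum>f\<in>F. of_bool (D f H K))"
  unfolding pr_eq_expectation
  by (subst Bochner_Integration.integral_sum[symmetric]) (simp_all add: case_prod_unfold)

section \<open>Resampling a single edge\<close>

text \<open>Moving \<open>f\<close> from the online set into the sample replaces a factor
  \<open>1 - p\<close> by \<open>p * q\<close>, that is, multiplies the probability of the pair by
  \<open>l\<close>. No division by \<open>1 - p\<close> occurs, so \<open>p = 1\<close> is
  covered.\<close>

lemma pr_flip:
  assumes f: "f \<in> E"
    and D: "\<And>H K. H \<subseteq> E \<Longrightarrow> K \<subseteq> H \<Longrightarrow> f \<notin> H \<Longrightarrow> D (insert f H) (insert f K) = D H K"
  shows "pr (\<lambda>H K. f \<in> K \<and> D H K) = l * pr (\<lambda>H K. f \<notin> H \<and> D H K)"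
proof -
  let ?i = "\<lambda>(H, K). (insert f H, insert f K)" and ?j = "\<lambda>(H, K). (H - {f}, K - {f})"
  have weight: "pmf joint (insert f H, insert f K) = l * pmf joint (H, K)"
    if HK: "H \<subseteq> E" "K \<subseteq> H" "f \<notin> H" for H K
  proof -
    have fin: "finite H" "finite K"
      using HK finite_E by (meson finite_subset)+
    have "E - H = insert f (E - insert f H)"
      using HK f by auto
    then have card_compl: "card (E - H) = Suc (card (E - insert f H))"
      using finite_E by (metis DiffE card_insert_disjoint finite_Diff insertI1)
    have "insert f H - insert f K = H - K" "f \<notin> K"
      using HK by auto
    then have "pmf joint (insert f H, insert f K) =
        (p * q) * (p ^ card H * (1 - p) ^ card (E - insert f H) * (q ^ card K * (1 - q) ^ card (H - K)))"
      using HK f fin by (subst pmf_joint) (auto simp: mult_ac)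
    also have "\<dots> = l * pmf joint (H, K)"
      unfolding pq using HK card_compl by (simp add: pmf_joint mult_ac)
    finally show ?thesis .
  qed
  \<comment> \<open>Inserting \<open>f\<close> into both sets and removing it from both are inverse
    bijections between the two events, because \<open>D\<close> does not notice the change.\<close>
  have "pr (\<lambda>H K. f \<in> K \<and> D H K) =
      (\<Sum>x\<in>{(H, K). H \<subseteq> E \<and> K \<subseteq> H \<and> f \<notin> H \<and> D H K}. l * pmf joint x)"
    unfolding pr_eq_sum
  proof (rule sum.reindex_bij_witness[of _ ?i ?j])
    fix x assume "x \<in> {(H, K). H \<subseteq> E \<and> K \<subseteq> H \<and> f \<in> K \<and> D H K}"
    then obtain H K where x: "x = (H, K)" "H \<subseteq> E" "K \<subseteq> H" "f \<in> K" "D H K"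
      by auto
    then have "f \<in> H"
      by blast
    with x have "D (H - {f}) (K - {f})"
      using D[of "H - {f}" "K - {f}"] by (auto simp: insert_absorb)
    then show "?j x \<in> {(H, K). H \<subseteq> E \<and> K \<subseteq> H \<and> f \<notin> H \<and> D H K}"
      using x by auto
    show "?i (?j x) = x"
      using x \<open>f \<in> H\<close> by auto
    show "l * pmf joint (?j x) = pmf joint x"
    proof -
      have "H - {f} \<subseteq> E" "K - {f} \<subseteq> H - {f}" "f \<notin> H - {f}"
        using x by auto
      then show ?thesis
        using weight[of "H - {f}" "K - {f}"] x \<open>f \<in> H\<close> by (simp add: insert_absorb)
    qed
  qed (use f D in auto)
  also have "\<dots> = l * pr (\<lambda>H K. f \<notin> H \<and> D H K)"
    unfolding pr_eq_sum by (simp add: sum_distrib_left)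
  finally show ?thesis .
qed

lemma pr_gr:
  assumes "e \<in> E"
  shows "pr (\<lambda>H K. e \<in> gr K) = l * pr (\<lambda>H K. e \<notin> H \<and> cand K e)"
  using pr_flip[of e "\<lambda>H K. cand K e"] assms by (simp add: mem_gr_iff cand_insert_later)

text \<open>
  The first later candidate edge at \<open>u\<close> that is not discarded lies in the sample \<open>l\<close> times as often as
  it is online, and once it is in the sample, it rules out every later candidate at \<open>u\<close>.
\<close>

lemma pr_later:
  assumes e: "e \<in> E"
  shows "(1 + l) * pr (\<lambda>H K. e \<notin> H \<and> cand K e \<and>
            (\<exists>f\<in>E. f \<notin> H \<and> cand K f \<and> u \<in> f \<and> r e < r f))
         \<le> pr (\<lambda>H K. e \<notin> H \<and> cand K e)" (is "_ * pr ?B \<le> pr ?A")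
proof -
  define F where "F = {f \<in> E. u \<in> f \<and> r e < r f}"
  \<comment> \<open>\<open>f\<close> is a candidate and no online candidate at \<open>u\<close> lies
    between \<open>e\<close> and \<open>f\<close>. The event leaves open whether \<open>f\<close> is
    online, sampled or discarded, and concerns only edges ranked up to \<open>f\<close>, so
    \<open>f\<close> can be resampled.\<close>
  define C where "C = (\<lambda>f H K. e \<notin> H \<and> cand K e \<and> cand K f \<and>
      (\<forall>g\<in>F. g \<notin> H \<and> cand K g \<longrightarrow> \<not> r g < r f))"
  have fin: "finite F"
    unfolding F_def using finite_E by simp
  have FE: "f \<in> F \<Longrightarrow> f \<in> E" for f
    unfolding F_def by simp
  have flip: "pr (\<lambda>H K. f \<in> K \<and> C f H K) = l * pr (\<lambda>H K. f \<notin> H \<and> C f H K)" if f: "f \<in> F" for f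
  proof (rule pr_flip)
    show "f \<in> E"
      using f FE by blast
    fix H K
    assume "H \<subseteq> E" "K \<subseteq> H" "f \<notin> H"
    have cand_eq: "cand (insert f K) g \<longleftrightarrow> cand K g" if "g \<in> E" "r g \<le> r f" for g
      using that by (rule cand_insert_later)
    have ef: "e \<noteq> f" "cand (insert f K) e = cand K e" "cand (insert f K) f = cand K f"
      using f e by (auto simp: F_def cand_eq)
    have "(g \<notin> insert f H \<and> cand (insert f K) g \<longrightarrow> \<not> r g < r f) =
        (g \<notin> H \<and> cand K g \<longrightarrow> \<not> r g < r f)" if "g \<in> F" for g
      using cand_eq[of g] FE[OF that] by (cases "r g < r f") auto
    then have ball: "(\<forall>g\<in>F. g \<notin> insert f H \<and> cand (insert f K) g \<longrightarrow> \<not> r g < r f) =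
        (\<forall>g\<in>F. g \<notin> H \<and> cand K g \<longrightarrow> \<not> r g < r f)"
      by (rule ball_cong[OF refl])
    show "C f (insert f H) (insert f K) = C f H K"
      unfolding C_def ball using ef by simp
  qed
  \<comment> \<open>Union bound: if some later online candidate exists at \<open>u\<close>, the one
    of least rank satisfies \<open>C\<close>.\<close>
  have "pr ?B \<le> (\<Sum>f\<in>F. pr (\<lambda>H K. f \<notin> H \<and> C f H K))"
    unfolding pr_eq_expectation[of ?B] sum_pr_eq_expectation
  proof (rule joint_mono)
    fix H K
    let ?S = "{f \<in> F. f \<notin> H \<and> cand K f}"
    show "of_bool (?B H K) \<le> (\<Sum>f\<in>F. of_bool (f \<notin> H \<and> C f H K) :: real)"
    proof (cases "?B H K")
      case True
      then have "?S \<noteq> {}"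
        unfolding F_def by blast
      then obtain f where f: "f \<in> ?S" "\<And>g. g \<in> ?S \<Longrightarrow> \<not> r g < r f"
        using arg_min_if_finite[of ?S r] fin that[of "arg_min_on r ?S"] by fastforce
      then have "f \<notin> H \<and> C f H K"
        using True unfolding C_def by blast
      then show ?thesis
        using True f(1) fin member_le_sum[of f F "\<lambda>f. of_bool (f \<notin> H \<and> C f H K) :: real"] by auto
    next
      case False
      then show ?thesis
        by (simp only: of_bool_eq) (simp add: sum_nonneg del: sum_of_bool_eq)
    qed
  qed
  then have "(1 + l) * pr ?B \<le> (\<Sum>f\<in>F. (1 + l) * pr (\<lambda>H K. f \<notin> H \<and> C f H K))"
    using l unfolding sum_distrib_left[symmetric] by (intro mult_left_mono) auto
  \<comment> \<open>The factor \<open>1 + l\<close> adds the sampled case to the online one, by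
    \<open>flip\<close>.\<close>
  also have "\<dots> = (\<Sum>f\<in>F. pr (\<lambda>H K. f \<notin> H \<and> C f H K)) + (\<Sum>f\<in>F. pr (\<lambda>H K. f \<in> K \<and> C f H K))"
    using flip by (simp add: sum.distrib[symmetric] algebra_simps cong: sum.cong)
  also have "\<dots> = measure_pmf.expectation joint
      (\<lambda>(H, K). \<Sum>f\<in>F. of_bool (f \<notin> H \<and> C f H K) + of_bool (f \<in> K \<and> C f H K))"
    unfolding sum_pr_eq_expectation
    by (subst Bochner_Integration.integral_add[symmetric])
      (simp_all add: case_prod_unfold sum.distrib)
  also have "\<dots> \<le> pr ?A"
    unfolding pr_eq_expectation
  proof (rule joint_mono)
    fix H K :: "'a set set"
    assume "H \<subseteq> E" "K \<subseteq> H"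
    let ?S = "{f \<in> F. (f \<notin> H \<or> f \<in> K) \<and> C f H K}"
    \<comment> \<open>Let \<open>f\<close> precede \<open>g\<close>. As \<open>C\<close> holds for
      \<open>g\<close>, the candidate \<open>f\<close> is not online, hence sampled, hence in the
      greedy matching. It then blocks \<open>g\<close> at \<open>u\<close>.\<close>
    have first: "f = g" if "f \<in> ?S" "g \<in> ?S" "\<not> r g < r f" for f g
    proof (rule ccontr)
      assume "f \<noteq> g"
      then have "r f < r g"
        using that rank_weight(2)[of f g] FE by auto
      have "u \<in> f \<inter> g" "cand K g" "cand K f" "f \<notin> H \<or> f \<in> K" "f \<in> E"
        using that by (auto simp: F_def C_def)
      moreover have "f \<in> H"
        using that \<open>r f < r g\<close> unfolding C_def by blast
      ultimately show False
        using \<open>r f < r g\<close> mem_gr_iff[of f K] unfolding cand_def[of K g] by blast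
    qed
    have "card ?S \<le> 1"
    proof -
      have "f = g" if "f \<in> ?S" "g \<in> ?S" for f g
        using first[OF that] first[OF that(2,1)] by (cases "r g < r f") auto
      moreover have "finite ?S"
        using fin by simp
      ultimately show ?thesis
        unfolding One_nat_def by (simp only: card_le_Suc0_iff_eq) blast
    qed
    have "(\<Sum>f\<in>F. of_bool (f \<notin> H \<and> C f H K) + of_bool (f \<in> K \<and> C f H K)) =
        (\<Sum>f\<in>F. of_bool ((f \<notin> H \<or> f \<in> K) \<and> C f H K) :: real)"
      using \<open>K \<subseteq> H\<close> by (intro sum.cong) auto
    also have "\<dots> = real (card ?S)"
      using fin by (simp add: Int_def)
    also have "\<dots> \<le> of_bool (?A H K)"
    proof (cases "?S = {}")
      case True
      then show ?thesis
        by (simp only:) simp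
    next
      case False
      then show ?thesis
        using \<open>card ?S \<le> 1\<close> unfolding C_def by auto
    qed
    finally show "(\<Sum>f\<in>F. of_bool (f \<notin> H \<and> C f H K) + of_bool (f \<in> K \<and> C f H K))
        \<le> (of_bool (?A H K) :: real)" .
  qed
  finally show ?thesis .
qed


section \<open>Expected weights and the competitive ratio\<close>

definition alg :: "('a set set \<Rightarrow> 'a set list) \<Rightarrow> 'a set set \<Rightarrow> 'a set set \<Rightarrow> 'a set set" where
  "alg \<sigma> H K = greedy_edge_arrival w ties K (\<sigma> H)"

text \<open>For fixed \<open>H\<close> and \<open>K\<close> the output is a maximal matching among
  the online candidates in every arrival order, so \<open>maximal_matching_weight\<close> applies.
  Indicators over all of \<open>E\<close> prepare for linearity of expectation.\<close>

lemma alg_weight: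
  assumes \<sigma>: "\<sigma> H \<in> permutations_of_set (E - H)"
  shows "(\<Sum>e\<in>E. w e * (of_bool (e \<notin> H \<and> cand K e) -
           (\<Sum>u\<in>e. of_bool (e \<notin> H \<and> cand K e \<and>
              (\<exists>f\<in>E. f \<notin> H \<and> cand K f \<and> u \<in> f \<and> r e < r f)))))
         \<le> sum w (alg \<sigma> H K)"
proof -
  define A where "A = {e \<in> E. e \<notin> H \<and> cand K e}"
  define M where "M = alg \<sigma> H K"
  have set_\<sigma>: "set (\<sigma> H) = E - H"
    using \<sigma> by (simp add: permutations_of_set_def)
  have M: "M = first_fit (\<lambda>e. e \<in> gr (insert e K)) (\<sigma> H)"
    unfolding M_def alg_def greedy_edge_arrival_eq_first_fit ..
  have A: "A = {e \<in> set (\<sigma> H). e \<in> gr (insert e K)}"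
    unfolding A_def set_\<sigma> using mem_gr_insert_iff by auto
  have "sum w A - sum w M \<le> (\<Sum>e\<in>A. \<Sum>u\<in>e. if \<exists>f\<in>A. u \<in> f \<and> r e < r f then w e else 0)"
  proof (rule maximal_matching_weight)
    show "M \<subseteq> A" "matching M"
      unfolding M A by (rule first_fit_subset matching_first_fit)+
    show "\<exists>f\<in>M. e \<inter> f \<noteq> {}" if "e \<in> A" "e \<notin> M" for e
      unfolding M by (rule first_fit_blocked) (use that in \<open>simp_all add: M A\<close>)
  qed (simp add: A_def)
  then have "(\<Sum>e\<in>A. w e - (\<Sum>u\<in>e. if \<exists>f\<in>A. u \<in> f \<and> r e < r f then w e else 0)) \<le> sum w M"
    by (simp add: sum_subtractf)
  also have "(\<Sum>e\<in>A. w e - (\<Sum>u\<in>e. if \<exists>f\<in>A. u \<in> f \<and> r e < r f then w e else 0)) =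
      (\<Sum>e\<in>E. w e * (of_bool (e \<notin> H \<and> cand K e) -
           (\<Sum>u\<in>e. of_bool (e \<notin> H \<and> cand K e \<and>
              (\<exists>f\<in>E. f \<notin> H \<and> cand K f \<and> u \<in> f \<and> r e < r f)))))"
  proof (rule sum.mono_neutral_cong_left)
    fix e
    assume "e \<in> A"
    then show "w e - (\<Sum>u\<in>e. if \<exists>f\<in>A. u \<in> f \<and> r e < r f then w e else 0) =
        w e * (of_bool (e \<notin> H \<and> cand K e) -
           (\<Sum>u\<in>e. of_bool (e \<notin> H \<and> cand K e \<and>
              (\<exists>f\<in>E. f \<notin> H \<and> cand K f \<and> u \<in> f \<and> r e < r f))))"
      by (auto simp: A_def right_diff_distrib sum_distrib_left intro!: sum.cong)
  next
    show "\<forall>e\<in>E - A. w e * (of_bool (e \<notin> H \<and> cand K e) -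
           (\<Sum>u\<in>e. of_bool (e \<notin> H \<and> cand K e \<and>
              (\<exists>f\<in>E. f \<notin> H \<and> cand K f \<and> u \<in> f \<and> r e < r f)))) = 0"
    proof
      fix e
      assume "e \<in> E - A"
      then have "e \<in> H \<or> \<not> cand K e"
        by (auto simp: A_def)
      then show "w e * (of_bool (e \<notin> H \<and> cand K e) -
           (\<Sum>u\<in>e. of_bool (e \<notin> H \<and> cand K e \<and>
              (\<exists>f\<in>E. f \<notin> H \<and> cand K f \<and> u \<in> f \<and> r e < r f)))) = 0"
        by (elim disjE) simp_all
    qed
  qed (auto simp: A_def finite_E)
  finally show ?thesis
    unfolding M_def .
qed

lemma expectation_gr:
  "measure_pmf.expectation joint (\<lambda>(H, K). sum w (gr K)) =
     l * (\<Sum>e\<in>E. w e * pr (\<lambda>H K. e \<notin> H \<and> cand K e))"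
proof -
  have "sum w (gr K) = (\<Sum>e\<in>E. w e * of_bool (e \<in> gr K))" for K
    using gr_subset(2) finite_E by (intro sum.mono_neutral_cong_left) auto
  then have "measure_pmf.expectation joint (\<lambda>(H, K). sum w (gr K)) =
      (\<Sum>e\<in>E. w e * pr (\<lambda>H K. e \<in> gr K))"
    unfolding pr_eq_expectation by (simp add: case_prod_unfold)
  also have "\<dots> = l * (\<Sum>e\<in>E. w e * pr (\<lambda>H K. e \<notin> H \<and> cand K e))"
    unfolding sum_distrib_left by (intro sum.cong) (simp_all add: pr_gr)
  finally show ?thesis .
qed

text \<open>Coupling: a thinning of the sample with probability \<open>1 / l\<close> is distributed
  like the online set, and \<open>opt\<close> is monotone. The true sample and online set are
  disjoint, but only their separate distributions matter here.\<close>

lemma expectation_opt_online: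
  "measure_pmf.expectation (random_subset p E) (\<lambda>H. opt w (E - H)) \<le>
     2 * measure_pmf.expectation joint (\<lambda>(H, K). sum w (gr K))"
proof -
  define R where "R = random_subset (p * q) E"
  define S where "S = bind_pmf R (\<lambda>X. map_pmf (Pair X) (random_subset (1 / l) X))"
  have pq01: "0 \<le> p * q" "p * q \<le> 1"
    using p q by (auto intro: mult_le_one)
  have l01: "0 \<le> 1 / l" "1 / l \<le> 1"
    using l by auto
  have set_S: "set_pmf S \<subseteq> Sigma (Pow E) Pow"
    unfolding S_def R_def using set_random_subset by fastforce
  have int: "integrable (measure_pmf S) (g :: _ \<Rightarrow> real)" for g
    by (rule integrable_measure_pmf_finite) (rule finite_subset[OF set_S finite_subset_pairs])
  have fst_S: "map_pmf fst S = R"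
    unfolding S_def by (simp add: map_bind_pmf pmf.map_comp o_def bind_return_pmf')
  have "map_pmf snd S = bind_pmf R (random_subset (1 / l))"
    unfolding S_def by (simp add: map_bind_pmf pmf.map_comp o_def)
  also have "\<dots> = random_subset (p * q * (1 / l)) E"
    unfolding R_def by (rule random_subset_random_subset[OF finite_E pq01 l01])
  also have "p * q * (1 / l) = 1 - p"
    unfolding pq using l by simp
  finally have snd_S: "map_pmf snd S = random_subset (1 - p) E" .
  have snd_joint: "map_pmf snd joint = R"
    unfolding joint_def R_def using random_subset_random_subset[OF finite_E p q]
    by (simp add: map_bind_pmf pmf.map_comp o_def)
  have "measure_pmf.expectation (random_subset p E) (\<lambda>H. opt w (E - H)) =
      measure_pmf.expectation (map_pmf (\<lambda>H. E - H) (random_subset p E)) (opt w)"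
    by simp
  also have "\<dots> = measure_pmf.expectation (map_pmf snd S) (opt w)"
    by (simp only: random_subset_compl[OF finite_E p] snd_S)
  also have "\<dots> = measure_pmf.expectation S (\<lambda>x. opt w (snd x))"
    by simp
  also have "\<dots> \<le> measure_pmf.expectation S (\<lambda>x. opt w (fst x))"
    by (intro integral_mono_AE int)
      (auto simp: AE_measure_pmf_iff intro!: opt_mono dest!: subsetD[OF set_S])
  also have "\<dots> = measure_pmf.expectation (map_pmf fst S) (opt w)"
    by simp
  also have "\<dots> = measure_pmf.expectation (map_pmf snd joint) (opt w)"
    by (simp only: fst_S snd_joint)
  also have "\<dots> = measure_pmf.expectation joint (\<lambda>(H, K). opt w K)"
    by (simp add: case_prod_unfold)
  also have "\<dots> \<le> measure_pmf.expectation joint (\<lambda>(H, K). 2 * sum w (gr K))"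
    by (rule joint_mono) (auto intro!: opt_le_two_gr)
  finally show ?thesis
    by (simp add: case_prod_unfold)
qed

lemma alg_competitive:
  assumes \<sigma>: "\<And>H. H \<subseteq> E \<Longrightarrow> \<sigma> H \<in> permutations_of_set (E - H)"
  shows "(l - 1) / (2 * l * (l + 1)) *
           measure_pmf.expectation (random_subset p E) (\<lambda>H. opt w (E - H))
         \<le> measure_pmf.expectation joint (\<lambda>(H, K). sum w (alg \<sigma> H K))"
proof -
  let ?A = "\<lambda>e H K. e \<notin> H \<and> cand K e"
  let ?B = "\<lambda>e u H K. e \<notin> H \<and> cand K e \<and> (\<exists>f\<in>E. f \<notin> H \<and> cand K f \<and> u \<in> f \<and> r e < r f)"
  \<comment> \<open>Each of the two endpoints costs at most a fraction \<open>1 / (1 + l)\<close> of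
    the probability that \<open>e\<close> is an online candidate.\<close>
  have edge: "(l - 1) / (l + 1) * pr (?A e) \<le> pr (?A e) - (\<Sum>u\<in>e. pr (?B e u))"
    if e: "e \<in> E" for e
  proof -
    have "pr (?B e u) \<le> pr (?A e) / (1 + l)" for u
      using pr_later[OF e, of u] l by (simp add: pos_le_divide_eq mult.commute)
    then have "(\<Sum>u\<in>e. pr (?B e u)) \<le> (\<Sum>u\<in>e. pr (?A e) / (1 + l))"
      by (intro sum_mono)
    also have "\<dots> = 2 * pr (?A e) / (1 + l)"
      using card_edge[OF e] by simp
    finally have "(\<Sum>u\<in>e. pr (?B e u)) \<le> 2 * pr (?A e) / (1 + l)" .
    moreover have "(l - 1) / (l + 1) * pr (?A e) = pr (?A e) - 2 * pr (?A e) / (1 + l)"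
      using l by (simp add: field_simps)
    ultimately show ?thesis
      by linarith
  qed
  have "(l - 1) / (2 * l * (l + 1)) *
      measure_pmf.expectation (random_subset p E) (\<lambda>H. opt w (E - H))
    \<le> (l - 1) / (2 * l * (l + 1)) * (2 * (l * (\<Sum>e\<in>E. w e * pr (?A e))))"
    using expectation_opt_online l unfolding expectation_gr by (intro mult_left_mono) auto
  also have "\<dots> = (\<Sum>e\<in>E. w e * ((l - 1) / (l + 1) * pr (?A e)))"
  proof -
    have "(l - 1) / (2 * l * (l + 1)) * (2 * (l * x)) = (l - 1) / (l + 1) * x" for x
    proof -
      have "l \<noteq> 0" "l + 1 \<noteq> 0"
        using l by auto
      then show ?thesis
        by (simp add: divide_simps)
    qed
    then show ?thesis
      by (simp only: sum_distrib_left[symmetric] mult.left_commute[of _ "(l - 1) / (l + 1)"])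
  qed
  also have "\<dots> \<le> (\<Sum>e\<in>E. w e * (pr (?A e) - (\<Sum>u\<in>e. pr (?B e u))))"
    using weight_nonneg edge by (intro sum_mono mult_left_mono)
  also have "\<dots> = measure_pmf.expectation joint (\<lambda>(H, K). \<Sum>e\<in>E. w e *
      (of_bool (?A e H K) - (\<Sum>u\<in>e. of_bool (?B e u H K))))"
    unfolding pr_eq_expectation
    by (simp add: case_prod_unfold del: sum_of_bool_eq)
  also have "\<dots> \<le> measure_pmf.expectation joint (\<lambda>(H, K). sum w (alg \<sigma> H K))"
    by (rule joint_mono) (rule alg_weight[OF \<sigma>])
  finally show ?thesis .
qed

end

theorem theorem5p11:
  fixes p :: real
  assumes "1 / sqrt 2 < p" and "p \<le> 1"
  shows "competitive p (3 / 2 - sqrt 2)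
           (greedy_based (random_subset ((1 + sqrt 2) * (1 - p) / p)) :: 'v algorithm)"
  unfolding competitive_def
proof (intro allI impI)
  fix V :: "'v set" and E and w :: "'v edge \<Rightarrow> real" and ties and \<sigma> :: "'v edge set \<Rightarrow> 'v edge list"
  assume graph: "fin_graph V E" and w: "\<forall>e\<in>E. 0 \<le> w e" and ties: "ties \<in> permutations_of_set E"
    and \<sigma>: "\<forall>H\<subseteq>E. \<sigma> H \<in> permutations_of_set (E - H)"
  define l where "l = 1 + sqrt 2"
  define q where "q = l * (1 - p) / p"
  have sqrt2: "sqrt 2 * sqrt 2 = 2" "1 < sqrt (2 :: real)"
    by simp_all
  have p: "0 < p"
    using assms(1) by (meson less_trans real_sqrt_gt_0_iff zero_less_divide_1_iff zero_less_numeral)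
  \<comment> \<open>The bound on \<open>p\<close> ensures \<open>q \<le> 1\<close>: the condition
    \<open>l * (1 - p) \<le> p\<close> means \<open>p \<ge> l / (1 + l)\<close>, which is
    \<open>1 / sqrt 2\<close>.\<close>
  have "1 < sqrt 2 * p"
    using assms(1) sqrt2 by (simp add: divide_less_eq mult.commute)
  then have "sqrt 2 * 1 < sqrt 2 * (sqrt 2 * p)" "1 < sqrt 2 * p"
    using sqrt2 by (auto simp only: mult_less_cancel_left_pos)
  then have "l * (1 - p) \<le> p"
    using sqrt2(1) unfolding l_def by (simp add: algebra_simps)
  then have q: "0 \<le> q" "q \<le> 1" "p * q = l * (1 - p)"
    using p assms(2) sqrt2 unfolding q_def l_def by (auto simp: divide_le_eq)
  have E: "E \<subseteq> Pow V" "\<And>e. e \<in> E \<Longrightarrow> card e = 2" "finite V"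
    using graph unfolding fin_graph_def by auto
  obtain r :: "'v edge \<Rightarrow> nat" where r: "sorted_wrt (\<lambda>a b. r a < r b) (sort_key (\<lambda>e. - w e) ties)"
    using obtain_rank[of "sort_key (\<lambda>e. - w e) ties"] ties by (auto simp: permutations_of_set_def)
  interpret sampled_graph E w ties r p q l
    by unfold_locales
      (use E w ties r p q assms sqrt2 in \<open>auto simp: l_def intro: finite_subset[of E "Pow V"]\<close>)
  \<comment> \<open>Since \<open>\<sigma>\<close> sees only \<open>H\<close>, the output
    distribution is an image of \<open>joint\<close>.\<close>
  have "bind_pmf (random_subset p E) (\<lambda>H. greedy_based (random_subset q) w ties H (\<sigma> H)) =
      map_pmf (\<lambda>(H, K). alg \<sigma> H K) joint"
    unfolding joint_def greedy_based_def alg_def by (simp add: map_bind_pmf pmf.map_comp o_def)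
  moreover have "(l - 1) / (2 * l * (l + 1)) = 3 / 2 - sqrt 2"
  proof -
    have "l - 1 = (3 / 2 - sqrt 2) * (2 * l * (l + 1))"
      using sqrt2(1) unfolding l_def by (simp add: algebra_simps)
    moreover have "2 * l * (l + 1) \<noteq> 0"
      using l by auto
    ultimately show ?thesis
      by (metis nonzero_mult_div_cancel_right)
  qed
  ultimately show "(3 / 2 - sqrt 2) * measure_pmf.expectation (random_subset p E) (\<lambda>H. opt w (E - H))
      \<le> measure_pmf.expectation
          (bind_pmf (random_subset p E) (\<lambda>H. greedy_based
            (random_subset ((1 + sqrt 2) * (1 - p) / p)) w ties H (\<sigma> H))) (\<lambda>M. sum w M)"
    using alg_competitive[of \<sigma>] \<sigma> unfolding q_def l_def by (simp add: case_prod_unfold)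
qed

end
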